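(* Let $S$ be a permutable semigroup satisfying a non-trivial permutation identity. Then $S$ is medial, that is, $xaby = xbay$ for all $x,a,b,y\in S$.
   Context: A semigroup $S$ is called permutable if any two congruences of $S$ commute, i.e. $\alpha\circ\beta=\beta\circ\alpha$ for all congruences $\alpha,\beta$ of $S$, where $\circ$ is composition of binary relations. A semigroup $S$ satisfies a non-trivial permutation identity if there exist a positive integer $n$ and a non-identity permutation $\sigma$ of $\{1,\dots,n\}$ such that $x_1x_2\cdots x_n = x_{\sigma(1)}x_{\sigma(2)}\cdots x_{\sigma(n)}$ for all $x_1,\dots,x_n\in S$. A semigroup $S$ is medial if it satisfies the identity $xaby=xbay$. *)

theory Defs
  imports Main "HOL-Combinatorics.Permutations"
begin

text \<open>A semigroup is a type of class \<open>semigroup_mult\<close>; properties of the semigroup as a whole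
  are predicates on the type token \<open>TYPE('a)\<close>.\<close>

definition congruence :: "('a::semigroup_mult \<times> 'a) set \<Rightarrow> bool" where
  "congruence \<alpha> \<longleftrightarrow> equiv UNIV \<alpha> \<and>
     (\<forall>a b c d. (a, b) \<in> \<alpha> \<longrightarrow> (c, d) \<in> \<alpha> \<longrightarrow> (a * c, b * d) \<in> \<alpha>)"

definition permutable :: "'a::semigroup_mult itself \<Rightarrow> bool" where
  "permutable (_ :: 'a itself) \<longleftrightarrow>
     (\<forall>\<alpha> \<beta> :: ('a \<times> 'a) set. congruence \<alpha> \<longrightarrow> congruence \<beta> \<longrightarrow> \<alpha> O \<beta> = \<beta> O \<alpha>)"

text \<open>A semigroup need not have a unit, so \<open>prod_list\<close> is not available. For \<open>n \<ge> 1\<close>,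
  \<open>seq_prod x n\<close> is the product \<open>x 1 * x 2 * \<dots> * x n\<close>; for \<open>n = 0\<close> it has the junk value \<open>x 1\<close>.\<close>

definition seq_prod :: "(nat \<Rightarrow> 'a::semigroup_mult) \<Rightarrow> nat \<Rightarrow> 'a" where
  "seq_prod x n = foldl (*) (x 1) (map x [2..<Suc n])"

lemma seq_prod_1: "seq_prod x (Suc 0) = x 1"
  by (simp add: seq_prod_def)

lemma seq_prod_Suc: "n \<ge> 1 \<Longrightarrow> seq_prod x (Suc n) = seq_prod x n * x (Suc n)"
  by (simp add: seq_prod_def)

text \<open>Since \<open>\<sigma> permutes {1..n}\<close> makes \<open>\<sigma>\<close> the identity outside \<open>{1..n}\<close>, \<open>\<sigma> \<noteq> id\<close> says that
  \<open>\<sigma>\<close> is not the identity on \<open>{1..n}\<close>.\<close>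

definition satisfies_nontrivial_permutation_identity :: "'a::semigroup_mult itself \<Rightarrow> bool" where
  "satisfies_nontrivial_permutation_identity (_ :: 'a itself) \<longleftrightarrow>
     (\<exists>n \<sigma>. n > 0 \<and> \<sigma> permutes {1..n} \<and> \<sigma> \<noteq> id \<and>
        (\<forall>x :: nat \<Rightarrow> 'a. seq_prod x n = seq_prod (\<lambda>i. x (\<sigma> i)) n))"

definition medial :: "'a::semigroup_mult itself \<Rightarrow> bool" where
  "medial (_ :: 'a itself) \<longleftrightarrow> (\<forall>x a b y :: 'a. x * a * b * y = x * b * a * y)"

end

theory Submission
  imports Defs
begin

text \<open>
  A non-trivial permutation identity yields \<open>k\<close> with \<open>u s t v = u t s v\<close> for all \<open>u, v \<in> S\<^sup>k\<close>
  (Putcha and Yaqub): some adjacent variables \<open>x\<^sub>i, x\<^sub>i\<^sub>+\<^sub>1\<close> occur on the right-hand side in the opposite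
  order, so replacing \<open>x\<^sub>i\<close> by \<open>x\<^sub>i z\<close> or \<open>x\<^sub>i\<^sub>+\<^sub>1\<close> by \<open>z x\<^sub>i\<^sub>+\<^sub>1\<close> moves \<open>z\<close> across the factors between them.
  This settles the case \<open>S = S\<^sup>2\<close>.
  If \<open>S \<noteq> S\<^sup>2\<close>, commuting with Rees congruences forces \<open>S = S\<^sup>2 \<union> {a}\<close>, and moreover every congruence
  that relates \<open>a\<close> to another element is universal. Suppose first that \<open>u s t = u t s\<close> for
  \<open>u \<in> S\<^sup>k\<close>. Applying the universality to congruences relating \<open>a\<close> and \<open>a\<^sup>2\<close> shows
  \<open>S = {a} \<union> a S\<close>; iterating, each element is a power of \<open>a\<close> or lies in \<open>a\<^sup>k S\<close>, so \<open>S\<close> is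
  commutative. Applied to the quotient of \<open>S\<close> by \<open>{(x, y). \<forall>v \<in> S\<^sup>k. x v = y v}\<close> and then to the
  opposite of \<open>S\<close>, this shows that \<open>S\<close> itself is commutative.
\<close>

section \<open>Congruences of permutable semigroups\<close>

text \<open>The operation and the predicate for congruences are parameters because the results are
  applied both to a semigroup and to its opposite, which has the same congruences.\<close>

locale permutable_semigroup = semigroup f
  for f :: "'a \<Rightarrow> 'a \<Rightarrow> 'a"  (infixl \<open>\<cdot>\<close> 70) +
  fixes cong :: "('a \<times> 'a) set \<Rightarrow> bool"
  assumes cong_iff: "cong \<alpha> \<longleftrightarrow> equiv UNIV \<alpha> \<and>
      (\<forall>a b c d. (a, b) \<in> \<alpha> \<longrightarrow> (c, d) \<in> \<alpha> \<longrightarrow> (a \<cdot> c, b \<cdot> d) \<in> \<alpha>)"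
    and cong_commute: "cong \<alpha> \<Longrightarrow> cong \<beta> \<Longrightarrow> \<alpha> O \<beta> = \<beta> O \<alpha>"
begin

lemma congI:
  assumes "\<And>x. (x, x) \<in> \<alpha>" "\<And>x y. (x, y) \<in> \<alpha> \<Longrightarrow> (y, x) \<in> \<alpha>"
    "\<And>x y z. (x, y) \<in> \<alpha> \<Longrightarrow> (y, z) \<in> \<alpha> \<Longrightarrow> (x, z) \<in> \<alpha>"
    "\<And>x y z. (x, y) \<in> \<alpha> \<Longrightarrow> (x \<cdot> z, y \<cdot> z) \<in> \<alpha>"
    "\<And>x y z. (x, y) \<in> \<alpha> \<Longrightarrow> (z \<cdot> x, z \<cdot> y) \<in> \<alpha>"
  shows "cong \<alpha>"
proof -
  have "equiv UNIV \<alpha>"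
    by (rule equivI) (auto simp: refl_on_def sym_def trans_def assms(1) intro: assms(2,3))
  then show ?thesis
    unfolding cong_iff using assms(3)[OF assms(4,5)] by simp
qed

lemma cong_refl: "cong \<alpha> \<Longrightarrow> (x, x) \<in> \<alpha>"
  by (simp add: cong_iff equiv_def refl_on_def)

lemma cong_sym: "cong \<alpha> \<Longrightarrow> (x, y) \<in> \<alpha> \<Longrightarrow> (y, x) \<in> \<alpha>"
  by (simp add: cong_iff equiv_def symD)

lemma cong_trans: "cong \<alpha> \<Longrightarrow> (x, y) \<in> \<alpha> \<Longrightarrow> (y, z) \<in> \<alpha> \<Longrightarrow> (x, z) \<in> \<alpha>"
  unfolding cong_iff equiv_def by (meson transD)

lemma cong_mult: "cong \<alpha> \<Longrightarrow> (x, y) \<in> \<alpha> \<Longrightarrow> (z, w) \<in> \<alpha> \<Longrightarrow> (x \<cdot> z, y \<cdot> w) \<in> \<alpha>"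
  by (simp add: cong_iff)

definition ideal :: "'a set \<Rightarrow> bool" where
  "ideal I \<longleftrightarrow> (\<forall>x\<in>I. \<forall>y. x \<cdot> y \<in> I \<and> y \<cdot> x \<in> I)"

definition rees :: "'a set \<Rightarrow> ('a \<times> 'a) set" where
  "rees I = Id \<union> I \<times> I"

lemma cong_rees: "ideal I \<Longrightarrow> cong (rees I)"
  by (rule congI) (auto simp: rees_def ideal_def)

text \<open>Rewriting \<open>\<sigma> O rees I\<close> as \<open>rees I O \<sigma>\<close> puts the
  Rees step first, and there it must fix \<open>x\<close>, which lies outside \<open>I\<close>.
  Permutability enters the arguments in this locale and its extensions only here.\<close>

lemma ideal_absorb:
  assumes "ideal I" "cong \<sigma>" "x \<notin> I" "y \<in> I" "z \<in> I" "(x, y) \<in> \<sigma>"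
  shows "(x, z) \<in> \<sigma>"
proof -
  have "(x, z) \<in> \<sigma> O rees I"
    using assms by (auto simp: rees_def)
  then have "(x, z) \<in> rees I O \<sigma>"
    using cong_commute[OF assms(2) cong_rees[OF assms(1)]] by simp
  then show ?thesis
    using assms(3) by (auto simp: rees_def)
qed

text \<open>Note the shift in the index: \<open>pow n\<close> is \<open>S\<^sup>n\<^sup>+\<^sup>1\<close>.\<close>

primrec pow :: "nat \<Rightarrow> 'a set" where
  "pow 0 = UNIV"
| "pow (Suc n) = {x \<cdot> y | x y. x \<in> pow n}"

lemma pow_mult_right: "x \<in> pow n \<Longrightarrow> x \<cdot> y \<in> pow n"
proof (induction n arbitrary: x y)
  case (Suc n)
  then show ?case by auto
qed simp

lemma pow_mult_left: "x \<in> pow n \<Longrightarrow> y \<cdot> x \<in> pow n"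
proof (induction n arbitrary: x y)
  case (Suc n)
  then obtain u v where "x = u \<cdot> v" "u \<in> pow n" by auto
  then have "y \<cdot> x = (y \<cdot> u) \<cdot> v" "y \<cdot> u \<in> pow n"
    using Suc.IH by (simp_all add: assoc)
  then show ?case by auto
qed simp

lemma ideal_pow: "ideal (pow n)"
  by (simp add: ideal_def pow_mult_left pow_mult_right)

lemma pow_mult_Suc: "x \<in> pow n \<Longrightarrow> x \<cdot> y \<in> pow (Suc n)"
  by auto

lemma pow_1: "x \<cdot> y \<in> pow 1"
  by auto

end

section \<open>Semigroups with an indecomposable element\<close>

locale indecomposable = permutable_semigroup +
  fixes a
  assumes a_notin: "a \<notin> pow 1"
begin

text \<open>All products lie in \<open>pow 1\<close>, so adjoining any element to it gives an ideal.
  If \<open>x\<close> were a second indecomposable element, absorption into the ideal containing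
  \<open>a\<close> would relate \<open>x\<close> to \<open>a\<close> in the Rees congruence of the
  ideal containing \<open>x\<close> but not \<open>a\<close>.\<close>

lemma pow_1_or_a: "x \<in> pow 1 \<or> x = a"
proof (rule ccontr)
  assume x: "\<not> ?thesis"
  have id: "ideal (insert y (pow 1))" for y
    using pow_1 by (auto simp: ideal_def)
  have "(x, a) \<in> rees (insert x (pow 1))"
    by (rule ideal_absorb[OF id[of a] cong_rees[OF id], of x "a \<cdot> a" a])
      (use x pow_1 in \<open>auto simp: rees_def\<close>)
  then show False
    using x a_notin by (auto simp: rees_def)
qed

text \<open>Since \<open>b\<close> must lie in the ideal \<open>pow 1\<close>, absorption spreads
  the relation from \<open>b\<close> to all of \<open>pow 1\<close>, which is everything except
  \<open>a\<close>.\<close>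

lemma cong_universal:
  assumes "cong \<sigma>" "(a, b) \<in> \<sigma>" "b \<noteq> a"
  shows "(a, x) \<in> \<sigma>"
proof (cases "x = a")
  case True
  then show ?thesis using cong_refl assms(1) by simp
next
  case False
  then show ?thesis
    using ideal_absorb[OF ideal_pow assms(1) a_notin _ _ assms(2)] pow_1_or_a assms(3) by blast
qed

lemma cong_universal_square: "cong \<sigma> \<Longrightarrow> (a, a \<cdot> a) \<in> \<sigma> \<Longrightarrow> (a, x) \<in> \<sigma>"
  using cong_universal a_notin pow_1 by metis

lemma generated_by_a:
  "s = a \<or> (\<exists>q. s = a \<cdot> q) \<or> (\<exists>p. s = p \<cdot> a) \<or> (\<exists>p q. s = p \<cdot> a \<cdot> q)"
proof -
  \<comment> \<open>The two-sided ideal generated by \<open>a\<close>. It contains both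
    \<open>a\<close> and \<open>a \<cdot> a\<close>, so its Rees congruence relates \<open>a\<close>
    to every element.\<close>
  define J where "J = {s. s = a \<or> (\<exists>q. s = a \<cdot> q) \<or> (\<exists>p. s = p \<cdot> a) \<or> (\<exists>p q. s = p \<cdot> a \<cdot> q)}"
  have J: "ideal J"
    unfolding ideal_def J_def by (auto simp: assoc) (metis assoc)+
  have "a \<in> J" "a \<cdot> a \<in> J"
    by (auto simp: J_def)
  have "s \<in> J"
  proof (cases "s = a")
    case False
    then have "(a, s) \<in> rees J"
      using ideal_absorb[OF ideal_pow cong_rees[OF J] a_notin pow_1[of a a], of s] pow_1_or_a
        \<open>a \<in> J\<close> \<open>a \<cdot> a \<in> J\<close>
      by (auto simp: rees_def)
    then show ?thesis using False by (auto simp: rees_def)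
  qed (use \<open>a \<in> J\<close> in simp)
  then show ?thesis by (simp add: J_def)
qed

text \<open>\<open>R i x\<close> stands for \<open>x a\<^sup>i\<close>, which makes sense for \<open>i = 0\<close> although \<open>a\<^sup>0\<close> does not.
  In particular \<open>R i a\<close> is \<open>a\<^sup>i\<^sup>+\<^sup>1\<close>.\<close>

definition R :: "nat \<Rightarrow> 'a \<Rightarrow> 'a" where
  "R i = ((\<lambda>x. x \<cdot> a) ^^ i)"

lemma R_0 [simp]: "R 0 x = x"
  by (simp add: R_def)

lemma R_Suc: "R (Suc i) x = R i x \<cdot> a"
  by (simp add: R_def)

lemma R_add: "R i (R j x) = R (i + j) x"
  by (simp add: R_def funpow_add)

lemma R_mult: "R i (x \<cdot> y) = x \<cdot> R i y"
  by (induction i) (simp_all add: R_Suc assoc)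

lemma R_mult_a: "R i x \<cdot> a = R (Suc i) x"
  by (simp add: R_Suc)

lemma R_mult_R_a: "R i x \<cdot> R j a = R (Suc (i + j)) x"
  by (metis R_add R_mult R_mult_a add.commute add_Suc_right)

lemma pow_R: "x \<in> pow n \<Longrightarrow> R i x \<in> pow n"
  by (induction i) (auto simp: R_Suc pow_mult_right)

lemma R_a_pow: "R n a \<in> pow n"
proof (induction n)
  case (Suc n)
  then show ?case using pow_mult_Suc[of "R n a" n a] by (simp only: R_Suc)
qed simp

text \<open>A last factor other than \<open>a\<close> is itself a product and lengthens the
  factorization; a last factor \<open>a\<close> leaves the remaining factors to the induction
  hypothesis.\<close>

lemma pow_step: "x \<in> pow n \<Longrightarrow> x \<in> pow (Suc n) \<or> x = R n a"
proof (induction n arbitrary: x)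
  case 0
  then show ?case using pow_1_or_a[of x] by simp
next
  case (Suc n)
  then obtain y z where x: "x = y \<cdot> z" and y: "y \<in> pow n" by auto
  show ?case
  proof (cases "z = a")
    case True
    with Suc.IH[OF y] show ?thesis
      using pow_mult_Suc x by (metis R_Suc)
  next
    case False
    then obtain z1 z2 where "z = z1 \<cdot> z2"
      using pow_1_or_a[of z] by auto
    then have "x = (y \<cdot> z1) \<cdot> z2" "y \<cdot> z1 \<in> pow (Suc n)"
      using x y pow_mult_Suc by (auto simp: assoc)
    then show ?thesis using pow_mult_Suc by blast
  qed
qed

lemma power_or_pow: "(\<exists>i. x = R i a) \<or> x \<in> pow n"
  by (induction n) (use pow_step in auto)

end

section \<open>Commutativity modulo a congruence\<close>

text \<open>Calculating modulo \<open>L\<close> replaces passing to a quotient semigroup. The two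
  instances are a congruence of equal action on \<open>pow k\<close>, and \<open>Id\<close> in the
  opposite semigroup.\<close>

locale left_medial_mod = indecomposable +
  fixes L :: "('a \<times> 'a) set" and k :: nat
  assumes cong_L: "cong L"
    and left_medial: "u \<in> pow k \<Longrightarrow> (u \<cdot> s \<cdot> t, u \<cdot> t \<cdot> s) \<in> L"
begin

abbreviation eqL (infix \<open>\<approx>\<close> 50) where "x \<approx> y \<equiv> (x, y) \<in> L"

lemmas L_refl = cong_refl[OF cong_L]
lemmas L_sym = cong_sym[OF cong_L]
lemmas L_trans [trans] = cong_trans[OF cong_L]
lemmas L_mult = cong_mult[OF cong_L]

lemma L_right: "x \<approx> y \<Longrightarrow> x \<cdot> z \<approx> y \<cdot> z"
  by (simp add: L_mult L_refl)

lemma L_left: "x \<approx> y \<Longrightarrow> z \<cdot> x \<approx> z \<cdot> y"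
  by (simp add: L_mult L_refl)

lemma L_R: "x \<approx> y \<Longrightarrow> R i x \<approx> R i y"
  by (induction i) (simp_all add: R_Suc L_right)

text \<open>The factors \<open>a\<close> pass \<open>x\<close> one at a time, because the prefix
  \<open>R i u\<close> stays in \<open>pow k\<close>.\<close>

lemma R_shift: "u \<in> pow k \<Longrightarrow> R i (u \<cdot> x) \<approx> R i u \<cdot> x"
proof (induction i)
  case (Suc i)
  have "R (Suc i) (u \<cdot> x) \<approx> R i u \<cdot> x \<cdot> a"
    using Suc by (simp add: R_Suc L_right)
  also have "R i u \<cdot> x \<cdot> a \<approx> R (Suc i) u \<cdot> x"
    using left_medial pow_R Suc.prems by (simp add: R_Suc)
  finally show ?case .
qed (simp add: L_refl)

section \<open>Comparison of arbitrary elements with powers of \<open>a\<close>\<close>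

text \<open>The relation \<open>A\<close>, agreement up to powers of \<open>a\<close> behind every
  prefix from \<open>pow k\<close>, is a congruence containing \<open>(a, a \<cdot> a)\<close>,
  hence universal.\<close>

lemma archimedean: "\<exists>i j. \<forall>u\<in>pow k. R i u \<cdot> x \<approx> R j u"
proof -
  define A where "A = {(x, y). \<exists>i j. \<forall>u\<in>pow k. R i u \<cdot> x \<approx> R j u \<cdot> y}"
  have AI: "(x, y) \<in> A" if "\<And>u. u \<in> pow k \<Longrightarrow> R i u \<cdot> x \<approx> R j u \<cdot> y" for x y i j
    using that unfolding A_def by blast
  have AE: thesis if "(x, y) \<in> A" "\<And>i j. (\<And>u. u \<in> pow k \<Longrightarrow> R i u \<cdot> x \<approx> R j u \<cdot> y) \<Longrightarrow> thesis"
    for x y thesis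
    using that unfolding A_def by blast
  have "cong A"
  proof (rule congI)
    show "(x, x) \<in> A" for x
      by (rule AI[of 0 _ 0]) (simp add: L_refl)
    show "(y, x) \<in> A" if "(x, y) \<in> A" for x y
      using that by (elim AE) (rule AI, rule L_sym)
    show "(x, z) \<in> A" if xy: "(x, y) \<in> A" and yz: "(y, z) \<in> A" for x y z
    proof -
      obtain i j where 1: "\<And>u. u \<in> pow k \<Longrightarrow> R i u \<cdot> x \<approx> R j u \<cdot> y"
        using AE[OF xy] by blast
      obtain i' j' where 2: "\<And>u. u \<in> pow k \<Longrightarrow> R i' u \<cdot> y \<approx> R j' u \<cdot> z"
        using AE[OF yz] by blast
      \<comment> \<open>As the exponents do not depend on the prefix, the two relations can be
        chained by using the prefixes \<open>R i' u\<close> and \<open>R j u\<close>.\<close>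
      have "R (i + i') u \<cdot> x \<approx> R (j' + j) u \<cdot> z" if u: "u \<in> pow k" for u
      proof -
        have "R (i + i') u \<cdot> x \<approx> R (i' + j) u \<cdot> y"
          using 1[OF pow_R[OF u, of i']] by (simp add: R_add add.commute)
        also have "R (i' + j) u \<cdot> y \<approx> R (j' + j) u \<cdot> z"
          using 2[OF pow_R[OF u, of j]] by (simp add: R_add)
        finally show ?thesis .
      qed
      then show ?thesis by (rule AI)
    qed
    show "(x \<cdot> z, y \<cdot> z) \<in> A" if xy: "(x, y) \<in> A" for x y z
    proof -
      obtain i j where 1: "\<And>u. u \<in> pow k \<Longrightarrow> R i u \<cdot> x \<approx> R j u \<cdot> y"
        using AE[OF xy] by blast
      show ?thesis
        by (rule AI[of i _ j]) (simp only: assoc[symmetric] 1 L_right)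
    qed
    show "(z \<cdot> x, z \<cdot> y) \<in> A" if xy: "(x, y) \<in> A" for x y z
    proof -
      obtain i j where 1: "\<And>u. u \<in> pow k \<Longrightarrow> R i u \<cdot> x \<approx> R j u \<cdot> y"
        using AE[OF xy] by blast
      have "R i u \<cdot> (z \<cdot> x) \<approx> R j u \<cdot> (z \<cdot> y)" if u: "u \<in> pow k" for u
      proof -
        have "R i u \<cdot> z \<cdot> x \<approx> R i (u \<cdot> z) \<cdot> x"
          by (rule L_right[OF L_sym[OF R_shift[OF u]]])
        also have "R i (u \<cdot> z) \<cdot> x \<approx> R j (u \<cdot> z) \<cdot> y"
          using 1 u pow_mult_right by blast
        also have "R j (u \<cdot> z) \<cdot> y \<approx> R j u \<cdot> z \<cdot> y"
          by (rule L_right[OF R_shift[OF u]])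
        finally show ?thesis by (simp add: assoc)
      qed
      then show ?thesis by (rule AI)
    qed
  qed
  moreover have "(a, a \<cdot> a) \<in> A"
    by (rule AI[of 1 _ 0]) (simp add: L_refl R_Suc assoc)
  ultimately have "(x, a) \<in> A"
    using cong_universal_square cong_sym by blast
  then show ?thesis
    by (elim AE) (metis R_mult_a)
qed

section \<open>The right ideal generated by \<open>a\<close> modulo \<open>L\<close>\<close>

definition Rt :: "'a set" where
  "Rt = {r. r \<approx> a \<or> (\<exists>t. r \<approx> a \<cdot> t)}"

lemma Rt_mult: "x \<in> Rt \<Longrightarrow> x \<cdot> y \<in> Rt"
  unfolding Rt_def using L_right by (auto simp: assoc) (metis L_right assoc)+

lemma Rt_R: "x \<in> Rt \<Longrightarrow> R i x \<in> Rt"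
  by (induction i) (simp_all add: R_Suc Rt_mult)

lemma Rt_cong: "x \<approx> y \<Longrightarrow> y \<in> Rt \<Longrightarrow> x \<in> Rt"
  unfolding Rt_def using L_trans by blast

lemma a_Rt: "a \<in> Rt"
  by (simp add: Rt_def L_refl)

text \<open>Powers of \<open>a\<close> lie in \<open>Rt\<close>, so everything outside
  \<open>Rt\<close> has long factorizations. Such elements can therefore serve as prefixes in
  \<open>left_medial\<close> and \<open>R_shift\<close>.\<close>

lemma notin_Rt_pow: "x \<notin> Rt \<Longrightarrow> x \<in> pow k"
  using power_or_pow[of x k] Rt_R[OF a_Rt] by auto

text \<open>By \<open>generated_by_a\<close>, an element outside \<open>Rt\<close> has the form
  \<open>p a\<close> or \<open>p a q\<close>. In the latter case \<open>p\<close> is outside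
  \<open>Rt\<close> too, and \<open>left_medial\<close> moves \<open>a\<close> to the right end;
  this is iterated.\<close>

lemma notin_Rt_R:
  assumes "s \<notin> Rt"
  shows "\<exists>s'. s' \<notin> Rt \<and> s \<approx> R i s'"
  using assms
proof (induction i arbitrary: s)
  case 0
  then show ?case using L_refl by auto
next
  case (Suc i)
  have "\<exists>s'. s' \<notin> Rt \<and> s \<approx> s' \<cdot> a"
  proof -
    have "s \<noteq> a" "s \<noteq> a \<cdot> q" for q
      using Suc.prems a_Rt Rt_mult by auto
    then consider p where "s = p \<cdot> a" | p q where "s = p \<cdot> a \<cdot> q"
      using generated_by_a[of s] by blast
    then show ?thesis
    proof cases
      case 1
      then show ?thesis using Suc.prems Rt_mult L_refl by blast
    next
      case 2
      then have "p \<notin> Rt" using Suc.prems Rt_mult by blast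
      then have *: "s \<approx> p \<cdot> q \<cdot> a"
        using 2 left_medial notin_Rt_pow by simp
      then show ?thesis using Suc.prems Rt_mult Rt_cong by blast
    qed
  qed
  then obtain t where t: "t \<notin> Rt" "s \<approx> t \<cdot> a" by blast
  obtain s' where s': "s' \<notin> Rt" "t \<approx> R i s'"
    using Suc.IH[OF t(1)] by blast
  have "s \<approx> R i s' \<cdot> a"
    using t(2) L_right[OF s'(2)] L_trans by blast
  then show ?case using s'(1) by (auto simp: R_Suc)
qed

text \<open>A high power of \<open>a\<close> is split off \<open>q\<close> on the right and traded
  for \<open>x\<close> by \<open>archimedean\<close>.\<close>

lemma notin_Rt_left_factor:
  assumes "q \<notin> Rt"
  shows "\<exists>z. z \<notin> Rt \<and> q \<approx> z \<cdot> x"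
proof -
  obtain i j where ij: "\<And>u. u \<in> pow k \<Longrightarrow> R i u \<cdot> x \<approx> R j u"
    using archimedean by blast
  obtain p where p: "p \<notin> Rt" "q \<approx> R j p"
    using notin_Rt_R[OF assms] by blast
  have "R j p \<approx> R i p \<cdot> x"
    using ij notin_Rt_pow p(1) L_sym by blast
  with p(2) have "q \<approx> R i p \<cdot> x"
    by (rule L_trans)
  then show ?thesis
    using assms Rt_cong Rt_mult by blast
qed

text \<open>The set \<open>E\<close> of elements with this property contains \<open>a\<close> and
  \<open>a \<cdot> a\<close>. The congruence \<open>T\<close> collapses \<open>E\<close> and is
  therefore universal, while \<open>E\<close> is a union of its classes.\<close>

lemma eventually_Rt: "\<exists>i. R i x \<in> Rt"
proof -
  define E where "E = {x. \<exists>i. R i x \<in> Rt}"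
  have Rt_E: "x \<in> E" if "x \<in> Rt" for x
    unfolding E_def using that by (metis (mono_tags) R_0 mem_Collect_eq)
  have E_cong: "y \<in> E" if "x \<in> E" "R i x \<approx> R j y" for x y i j
  proof -
    obtain h where "R h x \<in> Rt" using \<open>x \<in> E\<close> by (auto simp: E_def)
    then have "R h (R i x) \<in> Rt"
      using Rt_R[of "R h x" i] by (simp add: R_add add.commute)
    then have "R h (R j y) \<in> Rt"
      using Rt_cong L_R L_sym that(2) by blast
    then show ?thesis by (auto simp: E_def R_add)
  qed
  have E_right: "x \<cdot> z \<in> E" if "x \<in> E" for x z
  proof (cases "x \<in> Rt")
    case True
    then show ?thesis using Rt_E Rt_mult by blast
  next
    case False
    obtain i where "R i x \<in> Rt" using \<open>x \<in> E\<close> by (auto simp: E_def)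
    then have "R i (x \<cdot> z) \<in> Rt"
      using R_shift[OF notin_Rt_pow[OF False]] Rt_mult Rt_cong by blast
    then show ?thesis by (auto simp: E_def)
  qed
  define T where "T = {(x, y). (x \<in> E \<and> y \<in> E) \<or> (\<exists>i j. R i x \<approx> R j y)}"
  have "cong T"
  proof (rule congI)
    show "(x, x) \<in> T" for x
      unfolding T_def using L_refl by blast
    show "(y, x) \<in> T" if "(x, y) \<in> T" for x y
      using that unfolding T_def using L_sym by blast
    show "(x, z) \<in> T" if xy: "(x, y) \<in> T" and yz: "(y, z) \<in> T" for x y z
    proof (cases "y \<in> E")
      case True
      then have "x \<in> E" "z \<in> E"
        using xy yz E_cong L_sym unfolding T_def by blast+
      then show ?thesis by (simp add: T_def)
    next
      case False
      then obtain i j i' j' where 1: "R i x \<approx> R j y" and 2: "R i' y \<approx> R j' z"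
        using xy yz unfolding T_def by blast
      have "R i' (R i x) \<approx> R i' (R j y)"
        using 1 by (rule L_R)
      also have "R i' (R j y) \<approx> R j (R j' z)"
        using L_R[OF 2, of j] by (simp add: R_add add.commute)
      finally show ?thesis by (auto simp: T_def R_add)
    qed
    show "(x \<cdot> z, y \<cdot> z) \<in> T" if xy: "(x, y) \<in> T" for x y z
    proof (cases "x \<in> E")
      case True
      then have "y \<in> E" using xy E_cong unfolding T_def by blast
      then show ?thesis using True E_right by (simp add: T_def)
    next
      case False
      then obtain i j where 1: "R i x \<approx> R j y"
        using xy unfolding T_def by blast
      then have "y \<notin> E" using False E_cong L_sym by blast
      then have k: "x \<in> pow k" "y \<in> pow k"
        using False Rt_E notin_Rt_pow by blast+
      have "R i (x \<cdot> z) \<approx> R i x \<cdot> z"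
        using k by (simp add: R_shift)
      also have "R i x \<cdot> z \<approx> R j y \<cdot> z"
        using 1 by (rule L_right)
      also have "R j y \<cdot> z \<approx> R j (y \<cdot> z)"
        using k by (simp add: R_shift L_sym)
      finally show ?thesis by (auto simp: T_def)
    qed
    \<comment> \<open>No relation between \<open>x\<close> and \<open>y\<close> is assumed: both
      products lie in \<open>Rt\<close>, or \<open>archimedean\<close> compares each of them with
      powers of \<open>a\<close> behind \<open>z\<close>.\<close>
    show "(z \<cdot> x, z \<cdot> y) \<in> T" for x y z
    proof (cases "z \<in> Rt")
      case True
      then show ?thesis using Rt_E Rt_mult by (simp add: T_def)
    next
      case False
      then have z: "z \<in> pow k" by (rule notin_Rt_pow)
      have *: "\<exists>i j. R i (z \<cdot> x) \<approx> R j z" for x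
        using archimedean[of x] z R_shift[OF z] L_trans by blast
      obtain i j where 1: "R i (z \<cdot> x) \<approx> R j z" using * by blast
      obtain i' j' where 2: "R i' (z \<cdot> y) \<approx> R j' z" using * by blast
      have "R j' (R i (z \<cdot> x)) \<approx> R j' (R j z)"
        using 1 by (rule L_R)
      also have "R j' (R j z) \<approx> R j (R i' (z \<cdot> y))"
        using L_sym[OF L_R[OF 2, of j]] by (simp add: R_add add.commute)
      finally show ?thesis by (auto simp: T_def R_add)
    qed
  qed
  moreover have "(a, a \<cdot> a) \<in> T"
    using a_Rt Rt_E Rt_mult by (simp add: T_def)
  ultimately have "(a, x) \<in> T"
    by (rule cong_universal_square)
  then have "x \<in> E"
    using a_Rt Rt_E E_cong unfolding T_def by blast
  then show ?thesis by (simp add: E_def)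
qed

text \<open>Outside \<open>Rt\<close> one could write \<open>q \<approx> z \<cdot> q\<close> and
  \<open>q \<approx> R i q'\<close> with \<open>R i z \<in> Rt\<close>. Shifting the power of
  \<open>a\<close> from \<open>q'\<close> to \<open>z\<close> puts \<open>q\<close> into the right
  ideal \<open>Rt\<close>.\<close>

lemma in_Rt: "q \<in> Rt"
proof (rule ccontr)
  assume q: "q \<notin> Rt"
  obtain z where z: "z \<notin> Rt" "q \<approx> z \<cdot> q"
    using notin_Rt_left_factor[OF q] by blast
  obtain i where i: "R i z \<in> Rt"
    using eventually_Rt by blast
  obtain q' where q': "q \<approx> R i q'"
    using notin_Rt_R[OF q] by blast
  have "q \<approx> z \<cdot> R i q'"
    using z(2) L_left[OF q'] by (rule L_trans)
  also have "z \<cdot> R i q' \<approx> R i z \<cdot> q'"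
    using R_shift[OF notin_Rt_pow[OF z(1)]] by (simp add: R_mult)
  finally show False
    using q i Rt_mult Rt_cong by blast
qed

section \<open>Commutativity from multiples of high powers of \<open>a\<close>\<close>

text \<open>\<open>in_Rt\<close> is applied repeatedly to the remaining right factor
  \<open>t\<close>.\<close>

lemma power_or_multiple: "(\<exists>i. s \<approx> R i a) \<or> (\<exists>t. s \<approx> R n a \<cdot> t)"
proof (induction n)
  case 0
  then show ?case using in_Rt[of s] unfolding Rt_def by (auto intro: exI[of _ 0])
next
  case (Suc n)
  show ?case
  proof (cases "\<exists>i. s \<approx> R i a")
    case False
    with Suc obtain t where t: "s \<approx> R n a \<cdot> t" by blast
    consider "t \<approx> a" | t' where "t \<approx> a \<cdot> t'"
      using in_Rt[of t] unfolding Rt_def by blast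
    then show ?thesis
    proof cases
      case 1
      then have "s \<approx> R (Suc n) a"
        using L_trans[OF t] L_left by (simp add: R_Suc)
      then show ?thesis by blast
    next
      case 2
      then have "s \<approx> R (Suc n) a \<cdot> t'"
        using L_trans[OF t L_left[OF 2]] by (simp add: R_Suc assoc)
      then show ?thesis by blast
    qed
  qed blast
qed

theorem commutative_mod: "s \<cdot> t \<approx> t \<cdot> s"
proof -
  \<comment> \<open>The power \<open>a^(k+1)\<close>, which lies in \<open>pow k\<close>: every
    element is modulo \<open>L\<close> a power of \<open>a\<close> or a multiple
    \<open>c \<cdot> t\<close>, and the facts \<open>pp\<close>, \<open>pm\<close> and
    \<open>mm\<close> treat the possible pairs.\<close>
  define c where "c = R k a"
  have c: "c \<in> pow k" by (simp add: c_def R_a_pow)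
  have comm: "s \<cdot> t \<approx> t \<cdot> s" if "s \<approx> s'" "t \<approx> t'" "s' \<cdot> t' \<approx> t' \<cdot> s'" for s t s' t'
    using that L_mult L_sym L_trans by meson
  have pp: "R i a \<cdot> R j a = R j a \<cdot> R i a" for i j
    by (simp add: R_mult_R_a add.commute)
  have pm: "R i a \<cdot> (c \<cdot> t) \<approx> c \<cdot> t \<cdot> R i a" for i t
  proof -
    have "R i a \<cdot> (c \<cdot> t) = c \<cdot> R i a \<cdot> t"
      using pp by (metis assoc c_def)
    also have "c \<cdot> R i a \<cdot> t \<approx> c \<cdot> t \<cdot> R i a"
      using c by (rule left_medial)
    finally show ?thesis .
  qed
  have mm: "c \<cdot> s \<cdot> (c \<cdot> t) \<approx> c \<cdot> t \<cdot> (c \<cdot> s)" for s t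
  proof -
    have "c \<cdot> s \<cdot> (c \<cdot> t) \<approx> c \<cdot> (c \<cdot> t) \<cdot> s"
      using c by (rule left_medial)
    also have "c \<cdot> (c \<cdot> t) \<cdot> s \<approx> c \<cdot> t \<cdot> (c \<cdot> s)"
      using L_right[OF left_medial[OF c, of c t], of s] by (simp add: assoc)
    finally show ?thesis .
  qed
  show ?thesis
    using power_or_multiple[of s k] power_or_multiple[of t k] unfolding c_def[symmetric]
    by (metis comm pp pm mm L_refl L_sym)
qed

end

section \<open>Permutation identities\<close>

text \<open>Without a descent, injectivity makes \<tau> strictly increasing on
  \<open>{1..n}\<close>, so \<open>i \<le> \<tau> i\<close> throughout, which forces the
  identity.\<close>

lemma permutes_descent:
  fixes \<tau> :: "nat \<Rightarrow> nat"
  assumes "\<tau> permutes {1..n}" "\<tau> \<noteq> id"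
  shows "\<exists>i. 1 \<le> i \<and> i < n \<and> \<tau> (Suc i) < \<tau> i"
proof (rule ccontr)
  assume no: "\<not> ?thesis"
  have "i \<le> \<tau> i" if "1 \<le> i" "i \<le> n" for i
    using that
  proof (induction i rule: dec_induct)
    case base
    then show ?case using permutes_in_image[OF assms(1), of 1] by auto
  next
    case (step i)
    then have "\<tau> i \<le> \<tau> (Suc i)" using no by (meson Suc_le_lessD linorder_not_less)
    moreover have "\<tau> i \<noteq> \<tau> (Suc i)"
      using permutes_inj[OF assms(1)] by (simp add: inj_eq)
    ultimately show ?case using step by auto
  qed
  then have "\<tau> = id"
    using permutes_natset_ge[OF assms(1)] by auto
  then show False using assms(2) by simp
qed

lemma seq_prod_cong:
  "n \<ge> 1 \<Longrightarrow> (\<And>i. 1 \<le> i \<Longrightarrow> i \<le> n \<Longrightarrow> g i = h i) \<Longrightarrow> seq_prod g n = seq_prod h n"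
  by (induction n rule: dec_induct) (simp_all add: seq_prod_1 seq_prod_Suc)

lemma seq_prod_update_last:
  "m \<ge> 1 \<Longrightarrow> seq_prod (g(m := g m * z)) m = seq_prod g m * z"
proof (cases m)
  case (Suc p)
  then show ?thesis
    using seq_prod_cong[of p "g(m := g m * z)" g]
    by (cases p) (auto simp: seq_prod_1 seq_prod_Suc mult.assoc)
qed simp

lemma seq_prod_update_first:
  "m \<ge> 1 \<Longrightarrow> seq_prod (g(1 := z * g 1)) m = z * seq_prod g m"
  by (induction m rule: dec_induct) (simp_all add: seq_prod_1 seq_prod_Suc mult.assoc)

lemma seq_prod_add:
  assumes "m \<ge> 1" "n \<ge> 1"
  shows "seq_prod h (m + n) = seq_prod h m * seq_prod (\<lambda>i. h (m + i)) n"
  using assms(2)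
  by (induction n rule: dec_induct) (use assms(1) in \<open>simp_all add: seq_prod_1 seq_prod_Suc mult.assoc\<close>)

lemma seq_prod_shift_factor:
  assumes "1 \<le> i" "i < n"
  shows "seq_prod (g(i := g i * z)) n = seq_prod (g(Suc i := z * g (Suc i))) n"
proof -
  have "Suc i \<le> n" using assms by simp
  then show ?thesis
  proof (induction n rule: dec_induct)
    case base
    have "seq_prod (g(i := g i * z)) (Suc i) = seq_prod g i * z * g (Suc i)"
      using assms(1) seq_prod_update_last[of i g z] by (simp add: seq_prod_Suc)
    also have "\<dots> = seq_prod (g(Suc i := z * g (Suc i))) (Suc i)"
      using assms(1) seq_prod_cong[of i "g(Suc i := z * g (Suc i))" g]
      by (simp add: seq_prod_Suc mult.assoc)
    finally show ?case .
  qed (simp add: seq_prod_Suc)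
qed

text \<open>This is \<open>S^n\<close> for \<open>n \<ge> 1\<close>, without the index shift of
  \<open>pow\<close>.\<close>

definition seq_prods :: "nat \<Rightarrow> 'a::semigroup_mult set" where
  "seq_prods n = range (\<lambda>h. seq_prod h n)"

lemma seq_prod_in: "seq_prod h n \<in> seq_prods n"
  by (simp add: seq_prods_def)

lemma seq_prods_mult_right: "n \<ge> 1 \<Longrightarrow> x \<in> seq_prods n \<Longrightarrow> x * y \<in> seq_prods n"
  unfolding seq_prods_def by (auto simp flip: seq_prod_update_last)

lemma seq_prods_mult_left: "n \<ge> 1 \<Longrightarrow> x \<in> seq_prods n \<Longrightarrow> y * x \<in> seq_prods n"
  unfolding seq_prods_def by (auto simp flip: seq_prod_update_first)

lemma seq_prods_add:
  assumes "x \<in> seq_prods (m + n)" "m \<ge> 1" "n \<ge> 1"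
  obtains y z where "x = y * z" "y \<in> seq_prods m" "z \<in> seq_prods n"
proof -
  obtain h where "x = seq_prod h (m + n)" using assms(1) by (auto simp: seq_prods_def)
  then show ?thesis using that seq_prod_add[OF assms(2,3)] seq_prod_in by blast
qed

lemma seq_prods_antimono: "1 \<le> m \<Longrightarrow> m \<le> n \<Longrightarrow> seq_prods n \<subseteq> seq_prods m"
proof (cases "m = n")
  case False
  assume "1 \<le> m" "m \<le> n"
  with False have "n = m + (n - m)" "n - m \<ge> 1" by auto
  then show ?thesis
    using seq_prods_add[of _ m "n - m"] seq_prods_mult_right \<open>1 \<le> m\<close> by (metis subsetI)
qed simp

lemma seq_prods_Suc:
  assumes "n \<ge> 1"
  shows "seq_prods (Suc n) = {x * y | x y. x \<in> seq_prods n}"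
proof (intro equalityI subsetI)
  fix x :: 'a assume "x \<in> seq_prods (Suc n)"
  then show "x \<in> {x * y | x y. x \<in> seq_prods n}"
    using assms by (auto simp: seq_prods_def seq_prod_Suc)
next
  fix x :: 'a assume "x \<in> {x * y | x y. x \<in> seq_prods n}"
  then obtain h y where x: "x = seq_prod h n * y" by (auto simp: seq_prods_def)
  have "seq_prod (h(Suc n := y)) n = seq_prod h n"
    by (rule seq_prod_cong) (use assms in auto)
  then have "x = seq_prod (h(Suc n := y)) (Suc n)"
    using assms x by (simp add: seq_prod_Suc)
  then show "x \<in> seq_prods (Suc n)" by (simp add: seq_prod_in)
qed

text \<open>A factor \<open>z\<close> between two adjacent positions can be attached to either
  neighbour. At a descent of the inverse permutation these neighbours carry the variables
  \<open>l = \<tau> i\<close> and \<open>j = \<tau> (Suc i)\<close> with \<open>j < l\<close>, so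
  \<open>z\<close> jumps across the block from \<open>j\<close> to \<open>l\<close>.\<close>

lemma permutation_identity_move_factor:
  assumes "satisfies_nontrivial_permutation_identity TYPE('a::semigroup_mult)"
  shows "\<exists>n j l. 1 \<le> j \<and> j < l \<and> l \<le> n \<and>
    (\<forall>(h :: nat \<Rightarrow> 'a) z. seq_prod (h(l := h l * z)) n = seq_prod (h(j := z * h j)) n)"
proof -
  obtain n \<sigma> where \<sigma>: "\<sigma> permutes {1..n}" "\<sigma> \<noteq> id"
    and id: "\<And>x :: nat \<Rightarrow> 'a. seq_prod x n = seq_prod (\<lambda>i. x (\<sigma> i)) n"
    using assms unfolding satisfies_nontrivial_permutation_identity_def by blast
  define \<tau> where "\<tau> = inv \<sigma>"
  have \<tau>: "\<tau> permutes {1..n}" "\<tau> \<noteq> id"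
    unfolding \<tau>_def using permutes_inv[OF \<sigma>(1)] permutes_inv_inv[OF \<sigma>(1)] \<sigma>(2) by auto
  have \<tau>\<sigma>: "\<tau> (\<sigma> i) = i" for i
    unfolding \<tau>_def using permutes_inverses(2)[OF \<sigma>(1)] by simp
  obtain i where i: "1 \<le> i" "i < n" "\<tau> (Suc i) < \<tau> i"
    using permutes_descent[OF \<tau>] by blast
  have inj: "\<tau> r = \<tau> q \<longleftrightarrow> r = q" for r q
    using permutes_inj[OF \<tau>(1)] by (simp add: inj_eq)
  have ht: "seq_prod (h \<circ> \<tau>) n = seq_prod h n" for h :: "nat \<Rightarrow> 'a"
    using id[of "h \<circ> \<tau>"] by (simp add: \<tau>\<sigma>)
  have upd: "h(\<tau> r := y) \<circ> \<tau> = (h \<circ> \<tau>)(r := y)" for h :: "nat \<Rightarrow> 'a" and r y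
    by (auto simp: fun_eq_iff inj)
  have "seq_prod (h(\<tau> i := h (\<tau> i) * z)) n = seq_prod (h(\<tau> (Suc i) := z * h (\<tau> (Suc i)))) n"
    for h :: "nat \<Rightarrow> 'a" and z
    using seq_prod_shift_factor[OF i(1,2), of "h \<circ> \<tau>" z]
    unfolding o_apply upd[symmetric] ht .
  moreover have "1 \<le> \<tau> (Suc i)" "\<tau> i \<le> n"
    using permutes_in_image[OF \<tau>(1), of i] permutes_in_image[OF \<tau>(1), of "Suc i"] i by auto
  ultimately show ?thesis using i(3) by blast
qed

lemma permutation_identity_commute_long:
  assumes "satisfies_nontrivial_permutation_identity TYPE('a::semigroup_mult)"
  shows "\<exists>p m q. 1 \<le> p \<and> 1 \<le> m \<and> 1 \<le> q \<and>
    (\<forall>u\<in>seq_prods p. \<forall>w\<in>seq_prods m. \<forall>v\<in>seq_prods q. \<forall>z :: 'a.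
      u * w * z * v = u * z * w * v)"
proof -
  obtain n j l where jl: "1 \<le> j" "j < l" "l \<le> n"
    and move: "\<And>(h :: nat \<Rightarrow> 'a) z. seq_prod (h(l := h l * z)) n = seq_prod (h(j := z * h j)) n"
    using permutation_identity_move_factor[OF assms] by blast
  define m where "m = Suc (l - j)"
  define q where "q = Suc (n - l)"
  have m: "m \<ge> 1" and q: "q \<ge> 1" by (simp_all add: m_def q_def)
  have nn: "Suc (Suc n) = j + (m + q)"
    using jl by (simp add: m_def q_def)
  have n1: "n \<ge> 1" using jl by simp
  \<comment> \<open>One extra factor at each end keeps the outer words \<open>u\<close> and
    \<open>v\<close> nonempty even when \<open>j = 1\<close> or \<open>l = n\<close>.\<close>
  have pad: "seq_prod H (Suc (Suc n)) = H 1 * seq_prod (\<lambda>i. H (Suc i)) n * H (Suc (Suc n))"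
    for H :: "nat \<Rightarrow> 'a"
    using seq_prod_add[of 1 n H] n1 by (simp add: seq_prod_Suc seq_prod_1)
  have comm: "u * w * z * v = u * z * w * v"
    if "u \<in> seq_prods j" "w \<in> seq_prods m" "v \<in> seq_prods q" for u w z v :: 'a
  proof -
    obtain gu gw gv where u: "u = seq_prod gu j" and w: "w = seq_prod gw m" and v: "v = seq_prod gv q"
      using \<open>u \<in> seq_prods j\<close> \<open>w \<in> seq_prods m\<close> \<open>v \<in> seq_prods q\<close> by (auto simp: seq_prods_def)
    \<comment> \<open>The concatenation of \<open>gu\<close>, \<open>f\<close> and
      \<open>gv\<close>, of lengths \<open>j\<close>, \<open>m\<close> and \<open>q\<close>. Because
      of the padding, the block from \<open>j\<close> to \<open>l\<close> occupies positions
      \<open>Suc j\<close> to \<open>Suc l\<close>.\<close>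
    define G where "G f = (\<lambda>i. if i \<le> j then gu i else if i \<le> j + m then f (i - j) else gv (i - j - m))"
      for f :: "nat \<Rightarrow> 'a"
    have G: "seq_prod (G f) (Suc (Suc n)) = u * seq_prod f m * v" for f
    proof -
      have 1: "seq_prod (G f) j = u" unfolding u
        by (rule seq_prod_cong) (use jl in \<open>auto simp: G_def\<close>)
      have 2: "seq_prod (\<lambda>i. G f (j + i)) m = seq_prod f m"
        by (rule seq_prod_cong) (use m in \<open>auto simp: G_def\<close>)
      have 3: "seq_prod (\<lambda>i. G f (j + (m + i))) q = v" unfolding v
        by (rule seq_prod_cong) (use q in \<open>auto simp: G_def\<close>)
      show ?thesis
        unfolding nn using seq_prod_add[of j "m + q" "G f"] seq_prod_add[of m q "\<lambda>i. G f (j + i)"]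
          jl m q 1 2 3 by (simp add: mult.assoc)
    qed
    have last: "G (gw(m := gw m * z)) = (G gw)(Suc l := G gw (Suc l) * z)"
      using jl by (auto simp: G_def m_def fun_eq_iff)
    have first: "G (gw(1 := z * gw 1)) = (G gw)(Suc j := z * G gw (Suc j))"
      using jl by (auto simp: G_def m_def fun_eq_iff)
    have shift: "(\<lambda>i. (H(Suc r := y)) (Suc i)) = (\<lambda>i. H (Suc i))(r := y)" for H :: "nat \<Rightarrow> 'a" and r y
      by (auto simp: fun_eq_iff)
    have "seq_prod (G (gw(m := gw m * z))) (Suc (Suc n))
        = seq_prod (G (gw(1 := z * gw 1))) (Suc (Suc n))"
      unfolding pad last first shift
      using jl move[of "\<lambda>i. G gw (Suc i)" z] by simp
    then show ?thesis
      unfolding G w using seq_prod_update_last[OF m, of gw z] seq_prod_update_first[OF m, of gw z]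
      by (simp add: mult.assoc)
  qed
  show ?thesis
    by (intro exI[of _ j] exI[of _ m] exI[of _ q]) (use jl m q comm in blast)
qed

text \<open>A word \<open>y\<close> of length \<open>m\<close> is split off the end of
  \<open>u\<close>. It can absorb \<open>s\<close> or \<open>t\<close> and still commute with a
  single factor, and such moves exchange \<open>s\<close> and \<open>t\<close>.\<close>

theorem permutation_identity_commute:
  assumes "satisfies_nontrivial_permutation_identity TYPE('a::semigroup_mult)"
  shows "\<exists>k\<ge>1. \<forall>u\<in>seq_prods k. \<forall>v\<in>seq_prods k. \<forall>s t :: 'a. u * s * t * v = u * t * s * v"
proof -
  obtain p m q where pmq: "1 \<le> p" "1 \<le> m" "1 \<le> q"
    and comm: "\<And>u w v z :: 'a. \<lbrakk>u \<in> seq_prods p; w \<in> seq_prods m; v \<in> seq_prods q\<rbrakk>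
      \<Longrightarrow> u * w * z * v = u * z * w * v"
    using permutation_identity_commute_long[OF assms] by blast
  have "u * s * t * v = u * t * s * v"
    if u: "u \<in> seq_prods (p + m + q)" and v: "v \<in> seq_prods (p + m + q)" for u v s t :: 'a
  proof -
    have "u \<in> seq_prods (p + m)" and v: "v \<in> seq_prods q"
      using u v seq_prods_antimono[of "p + m" "p + m + q"] seq_prods_antimono[of q "p + m + q"] pmq
      by auto
    then obtain x y where xy: "u = x * y" "x \<in> seq_prods p" "y \<in> seq_prods m"
      using seq_prods_add pmq by blast
    have ys: "y * r \<in> seq_prods m" "r * y \<in> seq_prods m" "x * r \<in> seq_prods p" for r
      using xy pmq seq_prods_mult_left seq_prods_mult_right by blast+
    have "u * s * t * v = x * (y * s) * t * v" by (simp add: xy mult.assoc)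
    also have "\<dots> = x * t * (y * s) * v" by (rule comm[OF xy(2) ys(1) v])
    also have "\<dots> = x * (t * y) * s * v" by (simp add: mult.assoc)
    also have "\<dots> = x * s * (t * y) * v" by (rule comm[OF xy(2) ys(2) v])
    also have "\<dots> = x * s * t * y * v" by (simp add: mult.assoc)
    also have "\<dots> = x * s * y * t * v" by (rule comm[OF ys(3) xy(3) v, symmetric])
    also have "\<dots> = x * s * (y * t) * v" by (simp add: mult.assoc)
    also have "\<dots> = x * (y * t) * s * v" by (rule comm[OF xy(2) ys(1) v, symmetric])
    also have "\<dots> = u * t * s * v" by (simp add: xy mult.assoc)
    finally show ?thesis .
  qed
  then show ?thesis using pmq by (intro exI[of _ "p + m + q"]) auto
qed

section \<open>Mediality in the cases \<open>S = S^2\<close> and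
  \<open>S \<noteq> S^2\<close>\<close>

theorem corollary1:
  assumes "permutable TYPE('a::semigroup_mult)"
    and "satisfies_nontrivial_permutation_identity TYPE('a)"
  shows "medial TYPE('a)"
proof -
  interpret P: permutable_semigroup "(*) :: 'a \<Rightarrow> 'a \<Rightarrow> 'a" congruence
    by standard (use assms(1) in \<open>auto simp: congruence_def permutable_def mult.assoc\<close>)
  interpret Q: permutable_semigroup "\<lambda>x y :: 'a. y * x" congruence
  proof
    show "congruence \<alpha> \<longleftrightarrow> equiv UNIV \<alpha> \<and>
      (\<forall>a b c d. (a, b) \<in> \<alpha> \<longrightarrow> (c, d) \<in> \<alpha> \<longrightarrow> (c * a, d * b) \<in> \<alpha>)" for \<alpha> :: "('a \<times> 'a) set"
      unfolding congruence_def by blast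
  qed (use P.cong_commute in \<open>simp_all add: mult.assoc\<close>)
  have P_pow: "P.pow n = seq_prods (Suc n)" for n
  proof (induction n)
    case 0
    have "x \<in> seq_prods (Suc 0)" for x :: 'a
      using seq_prod_in[of "\<lambda>_. x" "Suc 0"] by (simp add: seq_prod_1)
    then show ?case by auto
  qed (auto simp: seq_prods_Suc)
  have Q_pow: "Q.pow n = P.pow n" for n
  proof (induction n)
    case (Suc n)
    have "y * x \<in> P.pow (Suc n)" if "x \<in> P.pow n" for x y
      using that
    proof (induction n arbitrary: x)
      case (Suc n)
      then obtain r s where "x = r * s" "r \<in> P.pow n" by auto
      with Suc.IH[of r] show ?case
        by (metis P.pow_mult_Suc mult.assoc)
    qed auto
    moreover have "x * y \<in> Q.pow (Suc n)" if "x \<in> Q.pow n" for x y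
      using that
    proof (induction n arbitrary: x)
      case (Suc n)
      then obtain r s where "x = s * r" "r \<in> Q.pow n" by auto
      with Suc.IH[of r] show ?case
        by (metis Q.pow_mult_Suc mult.assoc)
    qed auto
    ultimately show ?case using Suc by auto
  qed simp
  \<comment> \<open>The length found above is at least 1, hence of the form \<open>Suc k\<close>,
    matching the shifted index of \<open>pow\<close>.\<close>
  obtain k where k: "\<And>u v s t. u \<in> P.pow k \<Longrightarrow> v \<in> P.pow k \<Longrightarrow> u * s * t * v = u * t * s * v"
    using permutation_identity_commute[OF assms(2)] unfolding P_pow
    by (metis One_nat_def Suc_le_D)
  show ?thesis
  proof (cases "P.pow 1 = UNIV")
    case True
    have "P.pow n = UNIV" for n
    proof (induction n)
      case (Suc n)
      then show ?case using True by simp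
    qed simp
    then show ?thesis using k by (simp add: medial_def)
  next
    case False
    then obtain a where a: "a \<notin> P.pow 1" by blast
    \<comment> \<open>Modulo this congruence the right-hand context \<open>v\<close> disappears,
      which leaves the one-sided identity required of \<open>L\<close>.\<close>
    define L where "L = {(x, y). \<forall>v\<in>P.pow k. x * v = y * v}"
    have L: "congruence L"
      by (rule P.congI) (auto simp: L_def mult.assoc P.pow_mult_left)
    interpret A: left_medial_mod "(*) :: 'a \<Rightarrow> 'a \<Rightarrow> 'a" congruence a L k
      by standard (use a L k in \<open>auto simp: L_def\<close>)
    have st: "s * t * v = t * s * v" if "v \<in> P.pow k" for s t v
      using A.commutative_mod[of s t] that by (simp add: L_def)
    \<comment> \<open>Read in the opposite semigroup, \<open>st\<close> is the one-sided identity
      with prefix \<open>v\<close>, now holding exactly; so commutativity follows modulo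
      \<open>Id\<close>.\<close>
    interpret B: left_medial_mod "\<lambda>x y :: 'a. y * x" congruence a Id k
    proof
      show "a \<notin> Q.pow 1" using a by (simp add: Q_pow del: P.pow.simps Q.pow.simps)
      show "congruence (Id :: ('a \<times> 'a) set)" by (rule P.congI) auto
      show "(t * (s * u), s * (t * u)) \<in> Id" if "u \<in> Q.pow k" for u s t
        using that st[of u t s] by (simp add: Q_pow mult.assoc)
    qed
    have "s * t = t * s" for s t :: 'a
      using B.commutative_mod[of t s] by simp
    then show ?thesis
      unfolding medial_def by (metis mult.assoc)
  qed
qed

end
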